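(* Let $\{X_t\}_{t\in\mathbb Z}$ be a stationary process with distribution $P$ and values in a finite alphabet $\mathcal X$, and for each $n\ge 0$ let $\hat P(x\mid X^{-n})$ be a conditional probability mass function estimate based on $X^{-n}$ (that is, for every value of $X^{-n}$, $x\mapsto\hat P(x\mid X^{-n})$ is a probability mass function on $\mathcal X$). The sequence $\hat P(x\mid X^{-n})$ is consistent in expected information divergence, i.e. $$E_P\{I(P_{X|X^-}\,|\,\hat P_{X|X^{-n}})\}\to0\quad\text{as }n\to\infty,$$ if and only if $$\log\hat P(X\mid X^{-n})\to\log P(X\mid X^-)\quad\text{in }L^1(P).$$
   Context: Notation: $X=X_0$; $X^-=(\ldots,X_{-2},X_{-1})$; $X^{-n}=(X_{-n},\ldots,X_{-1})$ (empty for $n=0$); $P(x\mid X^-)=P\{X_0=x\mid X^-\}$; $P(X\mid X^-)$ and $\hat P(X\mid X^{-n})$ are these functions evaluated at $x=X_0$. Logarithms are in base 2. The conditional information divergence is the nonnegative (possibly infinite) function of the past $$I(P_{X|X^-}\,|\,\hat P_{X|X^{-n}})=\sum_{x\in\mathcal X}P(x\mid X^-)\log\left(\frac{P(x\mid X^-)}{\hat P(x\mid X^{-n})}\right),$$ with the usual conventions ($0\log0=0$, and value $+\infty$ if $\hat P(x\mid X^{-n})=0<P(x\mid X^-)$ for some $x$). *)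

theory Defs
  imports "HOL-Probability.Probability"
begin

definition stationary_process :: "'w measure \<Rightarrow> (int \<Rightarrow> 'w \<Rightarrow> 'a) \<Rightarrow> bool" where
  "stationary_process M X \<longleftrightarrow>
     prob_space M \<and>
     (\<forall>t. X t \<in> measurable M (count_space UNIV)) \<and>
     (\<forall>k. distr M (\<Pi>\<^sub>M t\<in>UNIV. count_space UNIV) (\<lambda>\<omega> t. X (t + k) \<omega>) =
          distr M (\<Pi>\<^sub>M t\<in>UNIV. count_space UNIV) (\<lambda>\<omega> t. X t \<omega>))"

definition past :: "(int \<Rightarrow> 'w \<Rightarrow> 'a) \<Rightarrow> 'w \<Rightarrow> (int \<Rightarrow> 'a)" where
  "past X \<omega> = (\<lambda>t\<in>{..<0}. X t \<omega>)"

definition past_algebra :: "'w measure \<Rightarrow> (int \<Rightarrow> 'w \<Rightarrow> 'a) \<Rightarrow> 'w measure" where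
  "past_algebra M X =
     vimage_algebra (space M) (past X) (\<Pi>\<^sub>M t\<in>{..<0::int}. count_space UNIV)"

(* A version of the conditional probability of X 0 = x given the infinite past. Only
   almost surely is it a probability mass function in x; everything below depends on it
   only up to null sets. *)
definition cond_prob_past :: "'w measure \<Rightarrow> (int \<Rightarrow> 'w \<Rightarrow> 'a) \<Rightarrow> 'a \<Rightarrow> 'w \<Rightarrow> real" where
  "cond_prob_past M X x = real_cond_exp M (past_algebra M X) (\<lambda>\<omega>. indicator {x} (X 0 \<omega>))"

(* The list [X (-n), ..., X (-1)]. *)
definition finite_past :: "(int \<Rightarrow> 'w \<Rightarrow> 'a) \<Rightarrow> nat \<Rightarrow> 'w \<Rightarrow> 'a list" where
  "finite_past X n \<omega> = map (\<lambda>i. X (int i - int n) \<omega>) [0..<n]"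

definition divergence_term :: "real \<Rightarrow> real \<Rightarrow> ereal" where
  "divergence_term p q =
     (if p = 0 then 0 else if q = 0 then \<infinity> else ereal (p * log 2 (p / q)))"

definition info_divergence :: "('a::finite \<Rightarrow> real) \<Rightarrow> 'a pmf \<Rightarrow> ereal" where
  "info_divergence p Q = (\<Sum>x\<in>UNIV. divergence_term (p x) (pmf Q x))"

(* The divergence is almost surely nonnegative, so that the truncation of negative values
   by e2ennreal changes it only on a null set. *)
definition expected_divergence ::
    "'w measure \<Rightarrow> (int \<Rightarrow> 'w \<Rightarrow> 'a::finite) \<Rightarrow> (nat \<Rightarrow> 'a list \<Rightarrow> 'a pmf) \<Rightarrow> nat \<Rightarrow> ennreal" where
  "expected_divergence M X Phat n =
     (\<integral>\<^sup>+ \<omega>. e2ennreal (info_divergence (\<lambda>x. cond_prob_past M X x \<omega>)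
                                      (Phat n (finite_past X n \<omega>))) \<partial>M)"

definition log2_ereal :: "real \<Rightarrow> ereal" where
  "log2_ereal p = (if p \<le> 0 then -\<infinity> else ereal (log 2 p))"

(* The limit is required to be integrable, but finitely many members of the sequence may
   fail to be: an estimate may give mass 0 to a symbol for small n. *)
definition tendsto_L1 :: "'w measure \<Rightarrow> (nat \<Rightarrow> 'w \<Rightarrow> ereal) \<Rightarrow> ('w \<Rightarrow> ereal) \<Rightarrow> bool" where
  "tendsto_L1 M f g \<longleftrightarrow>
     (\<forall>n. f n \<in> borel_measurable M) \<and> g \<in> borel_measurable M \<and>
     (\<integral>\<^sup>+ \<omega>. e2ennreal \<bar>g \<omega>\<bar> \<partial>M) < \<infinity> \<and>
     (\<lambda>n. \<integral>\<^sup>+ \<omega>. e2ennreal \<bar>f n \<omega> - g \<omega>\<bar> \<partial>M) \<longlonglongrightarrow> 0"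

end

theory Submission
  imports Defs
begin

text \<open>
  Write \<open>p(x)\<close> for the conditional probability of \<open>x\<close> given the infinite past and \<open>q(x)\<close> for the
  estimate. Both are functions of the past alone, so averaging first over the present symbol turns
  the \<open>L\<^sup>1\<close> distance of the log likelihoods into the expectation of
  \<open>\<Sum>x. p(x) \<bar>log q(x) - log p(x)\<bar>\<close> (\<open>nn_integral_disintegrate_present\<close>). The divergence is the
  sum of \<open>p(x) (log p(x) - log q(x))\<close>, without the absolute value. The theorem therefore reduces to
  comparing these two sums for a fixed past.

  The divergence is at most the absolute sum, which gives one direction. For the other, the two
  sums differ by twice the absolute value of the contribution of the negative terms
  \<open>p log (p / q)\<close>, those with \<open>q > p\<close>. The classical route bounds this by the total variation
  distance and hence, by Pinsker's inequality, by a multiple of the square root of the divergence;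
  Jensen's inequality then passes to expectations. The square root can be avoided: for every \<open>e > 0\<close>
  there is a constant \<open>K\<close> such that, pointwise, the absolute sum is at most \<open>K\<close> times the divergence plus
  \<open>e\<close> (\<open>mean_abs_log_ratio_le_divergence\<close>). This bound is affine, so it can be integrated as it
  stands, and it is obtained symbol by symbol from the quadratic lower bound on the exponential
  function. Letting first \<open>n\<close> tend to infinity and then \<open>e\<close> to zero finishes the argument.

  The integrability of the limit \<open>log p(X)\<close> is automatic, because its expected absolute value is an
  expected entropy of a distribution on a finite alphabet.
\<close>

section \<open>Divergence and mean absolute log ratio of two mass functions\<close>

text \<open>
  The product in \<^typ>\<open>ennreal\<close> has \<open>0 * \<infinity> = 0\<close>, so symbols with \<open>p x = 0\<close> do not contribute, whatever \<open>q x\<close> is, while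
  a symbol with \<open>q x = 0 < p x\<close> makes the value infinite. These are exactly the conventions for
  the divergence.
\<close>

definition mean_abs_log_ratio :: "('a::finite \<Rightarrow> real) \<Rightarrow> 'a pmf \<Rightarrow> ennreal" where
  "mean_abs_log_ratio p Q =
     (\<Sum>x\<in>UNIV. ennreal (p x) * e2ennreal \<bar>log2_ereal (pmf Q x) - log2_ereal (p x)\<bar>)"

text \<open>
  With \<open>t = ln (q / p)\<close>, the left-hand side is what distinguishes \<open>\<bar>t\<bar>\<close> from \<open>- t\<close>, and
  \<open>exp t - 1 - t\<close> is the integrand of the divergence after the addition of \<open>q / p - 1\<close>, whose mean
  is zero. For \<open>t \<le> 0\<close> the left-hand side vanishes. For positive \<open>t\<close> the excess
  \<open>exp t - 1 - t\<close> is at least \<open>t\<^sup>2 / 2\<close> and so dominates \<open>t\<close> except near the origin; the additive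
  \<open>e\<close> pays for the small \<open>t\<close>, by the inequality of arithmetic and geometric means.
\<close>

lemma abs_add_self_le_exp_excess:
  fixes t e :: real
  assumes "e > 0"
  shows "\<bar>t\<bar> + t \<le> e + 2 / e * (exp t - 1 - t)"
proof (cases "t \<le> 0")
  case True
  have "0 \<le> exp t - 1 - t"
    using exp_ge_add_one_self[of t] by linarith
  then have "0 \<le> 2 / e * (exp t - 1 - t)"
    using assms by (intro mult_nonneg_nonneg) auto
  then show ?thesis
    using True assms by simp
next
  case False
  have "e * (2 * t) \<le> e\<^sup>2 + t\<^sup>2"
    using sum_squares_bound[of e t] by (simp add: power2_eq_square algebra_simps)
  then have "2 * t \<le> e + 2 / e * (t\<^sup>2 / 2)"
    using assms by (simp add: field_simps power2_eq_square)
  also have "\<dots> \<le> e + 2 / e * (exp t - 1 - t)"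
    using exp_lower_Taylor_quadratic[of t] False assms
    by (intro add_left_mono mult_left_mono) auto
  finally show ?thesis
    using False by simp
qed

text \<open>
  The previous bound at \<open>t = ln (q / p)\<close>, multiplied by \<open>p\<close> and expressed in
  logarithms of base 2. The last summand cancels when the terms are added up over the alphabet, as \<open>p\<close> and \<open>q\<close> have the same total mass.
\<close>

lemma abs_log_ratio_term_le:
  fixes p q e :: real
  assumes p: "0 \<le> p" and q: "0 \<le> q" and ac: "q = 0 \<Longrightarrow> p = 0" and e: "e > 0"
  shows "p * \<bar>log 2 q - log 2 p\<bar>
           \<le> (1 + 2 / (e * ln 2)) * (p * log 2 (p / q)) + e * p + 2 / (e * (ln 2)\<^sup>2) * (q - p)"
proof (cases "p = 0")
  case True
  then show ?thesis using q e by simp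
next
  case False
  then have p: "p > 0" and q: "q > 0" using p q ac by (auto simp: less_le)
  define t where "t = ln q - ln p"
  have exp_t: "exp t = q / p"
    using p q by (simp add: t_def exp_diff)
  have log_t: "log 2 q - log 2 p = t / ln 2" "log 2 (p / q) = - t / ln 2"
    using p q by (simp_all add: t_def log_def diff_divide_distrib ln_div)
  (* The change of base divides the additive term by ln 2, so start from e * ln 2. *)
  have "\<bar>t\<bar> + t \<le> e * ln 2 + 2 / (e * ln 2) * (q / p - 1 - t)"
    using abs_add_self_le_exp_excess[of "e * ln 2" t] e exp_t by simp
  then have "p / ln 2 * (\<bar>t\<bar> + t) \<le> p / ln 2 * (e * ln 2 + 2 / (e * ln 2) * (q / p - 1 - t))"
    using p by (intro mult_left_mono) auto
  also have "\<dots> = e * p + 2 / (e * (ln 2)\<^sup>2) * (q - p) - 2 / (e * ln 2) * (p * (t / ln 2))"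
    using p e by (simp add: field_simps power2_eq_square)
  also have "p / ln 2 * (\<bar>t\<bar> + t) = p * \<bar>t / ln 2\<bar> + p * (t / ln 2)"
    by (simp add: abs_divide add_divide_distrib distrib_left)
  finally show ?thesis
    unfolding log_t by (simp add: distrib_right add_divide_distrib mult.assoc)
qed

lemma info_divergence_finite:
  assumes "\<And>x. pmf Q x = 0 \<Longrightarrow> p x = 0"
  shows "info_divergence p Q = ereal (\<Sum>x\<in>UNIV. p x * log 2 (p x / pmf Q x))"
  unfolding info_divergence_def sum_ereal[symmetric]
  by (intro sum.cong refl) (use assms in \<open>auto simp: divergence_term_def\<close>)

lemma mean_abs_log_ratio_finite:
  assumes p: "\<And>x. 0 \<le> p x" and ac: "\<And>x. pmf Q x = 0 \<Longrightarrow> p x = 0"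
  shows "mean_abs_log_ratio p Q = ennreal (\<Sum>x\<in>UNIV. p x * \<bar>log 2 (pmf Q x) - log 2 (p x)\<bar>)"
proof -
  have "ennreal (p x) * e2ennreal \<bar>log2_ereal (pmf Q x) - log2_ereal (p x)\<bar>
      = ennreal (p x * \<bar>log 2 (pmf Q x) - log 2 (p x)\<bar>)" for x
  proof (cases "p x = 0")
    case False
    then have "p x > 0" "pmf Q x > 0"
      using p[of x] ac[of x] pmf_nonneg[of Q x] by (auto simp: less_le)
    then show ?thesis
      by (simp add: log2_ereal_def ennreal_mult)
  qed simp
  then show ?thesis
    unfolding mean_abs_log_ratio_def using p by simp
qed

lemma divergence_le_mean_abs_log_ratio:
  assumes p: "\<And>x. 0 \<le> p x"
  shows "e2ennreal (info_divergence p Q) \<le> mean_abs_log_ratio p Q"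
proof (cases "\<exists>x. p x \<noteq> 0 \<and> pmf Q x = 0")
  case True
  then obtain x where x: "p x > 0" "pmf Q x = 0"
    using p by (metis less_eq_real_def)
  have "ennreal (p x) * e2ennreal \<bar>log2_ereal (pmf Q x) - log2_ereal (p x)\<bar> = \<top>"
    using x by (simp add: log2_ereal_def ennreal_mult_top)
  moreover have "ennreal (p x) * e2ennreal \<bar>log2_ereal (pmf Q x) - log2_ereal (p x)\<bar>
      \<le> mean_abs_log_ratio p Q"
    unfolding mean_abs_log_ratio_def by (rule member_le_sum) auto
  ultimately show ?thesis
    by (simp add: top_unique)
next
  case False
  then have ac: "\<And>x. pmf Q x = 0 \<Longrightarrow> p x = 0" by blast
  have "p x * log 2 (p x / pmf Q x) \<le> p x * \<bar>log 2 (pmf Q x) - log 2 (p x)\<bar>" for x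
  proof (cases "p x = 0")
    case False
    then have "p x > 0" "pmf Q x > 0"
      using p[of x] ac[of x] pmf_nonneg[of Q x] by (auto simp: less_le)
    then show ?thesis
      by (intro mult_left_mono) (auto simp: log_divide)
  qed simp
  then show ?thesis
    using ac p by (simp add: info_divergence_finite mean_abs_log_ratio_finite ennreal_leI sum_mono)
qed

text \<open>
  An affine substitute for Pinsker's inequality: the constant blows up as \<open>e\<close> tends to zero, but
  no square root of the divergence appears.
\<close>

lemma mean_abs_log_ratio_le_divergence:
  assumes p: "\<And>x. 0 \<le> p x" and sum_p: "(\<Sum>x\<in>UNIV. p x) = 1" and e: "e > 0"
  shows "mean_abs_log_ratio p Q
           \<le> ennreal (1 + 2 / (e * ln 2)) * e2ennreal (info_divergence p Q) + ennreal e"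
proof (cases "\<exists>x. p x \<noteq> 0 \<and> pmf Q x = 0")
  case True
  then obtain x where x: "p x \<noteq> 0" "pmf Q x = 0"
    by blast
  have "divergence_term (p x) (pmf Q x) = \<infinity>"
    using x by (simp add: divergence_term_def)
  then have "info_divergence p Q = \<infinity>"
    unfolding info_divergence_def sum_Pinfty by (intro conjI bexI[of _ x]) auto
  moreover have "1 + 2 / (e * ln 2) > 0"
    using e by (intro add_pos_pos) auto
  ultimately show ?thesis
    by (simp add: ennreal_mult_top)
next
  case False
  then have ac: "\<And>x. pmf Q x = 0 \<Longrightarrow> p x = 0" by blast
  define D where "D = (\<Sum>x\<in>UNIV. p x * log 2 (p x / pmf Q x))"
  have D: "info_divergence p Q = ereal D"
    using ac by (simp add: info_divergence_finite D_def)
  define K where "K = 1 + 2 / (e * ln 2)"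
  have K: "K > 0"
    unfolding K_def using e by (intro add_pos_pos) auto
  have sum_Q: "(\<Sum>x\<in>UNIV. pmf Q x) = 1"
    by (simp add: sum_pmf_eq_1)
  have "(\<Sum>x\<in>UNIV. p x * \<bar>log 2 (pmf Q x) - log 2 (p x)\<bar>)
      \<le> (\<Sum>x\<in>UNIV. K * (p x * log 2 (p x / pmf Q x)) + e * p x
            + 2 / (e * (ln 2)\<^sup>2) * (pmf Q x - p x))"
    unfolding K_def using p ac e by (intro sum_mono abs_log_ratio_term_le) auto
  also have "\<dots> = K * D + e"
    unfolding D_def sum.distrib sum_distrib_left[symmetric] sum_subtractf sum_p sum_Q by simp
  also have "\<dots> \<le> K * max 0 D + e"
    using K by (intro add_right_mono mult_left_mono) auto
  finally have "mean_abs_log_ratio p Q \<le> ennreal (K * max 0 D + e)"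
    using p ac by (simp add: mean_abs_log_ratio_finite ennreal_leI)
  also have "\<dots> = ennreal K * ennreal D + ennreal e"
    using K e by (simp add: ennreal_plus ennreal_mult max_def ennreal_neg)
  finally show ?thesis
    by (simp add: D K_def)
qed

text \<open>
  Each entropy term \<open>- p log p\<close> is bounded on the unit interval, since \<open>ln (1 / p) \<le> 1 / p - 1\<close>.
  The crude bound \<open>1 / ln 2\<close> per symbol is enough for integrability.
\<close>

lemma entropy_bound:
  fixes p :: "'a::finite \<Rightarrow> real"
  assumes p: "\<And>x. 0 \<le> p x" and p_le_1: "\<And>x. p x \<le> 1"
  shows "(\<Sum>x\<in>UNIV. ennreal (p x) * e2ennreal \<bar>log2_ereal (p x)\<bar>)
           \<le> ennreal (real CARD('a) / ln 2)"
proof -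
  have "ennreal (p x) * e2ennreal \<bar>log2_ereal (p x)\<bar> \<le> ennreal (1 / ln 2)" for x
  proof (cases "p x = 0")
    case False
    then have px: "p x > 0" using p[of x] by simp
    have "p x * \<bar>ln (p x)\<bar> = p x * ln (1 / p x)"
      using px p_le_1[of x] by (simp add: ln_div)
    also have "\<dots> \<le> p x * (1 / p x - 1)"
      using px by (intro mult_left_mono ln_le_minus_one) auto
    also have "\<dots> \<le> 1"
      using px by (simp add: field_simps)
    finally have "p x * \<bar>log 2 (p x)\<bar> \<le> 1 / ln 2"
      by (simp add: log_def divide_right_mono)
    then show ?thesis
      using px by (simp add: log2_ereal_def ennreal_mult[symmetric] ennreal_leI)
  qed simp
  then have "(\<Sum>x\<in>UNIV. ennreal (p x) * e2ennreal \<bar>log2_ereal (p x)\<bar>)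
      \<le> (\<Sum>x\<in>(UNIV::'a set). ennreal (1 / ln 2))"
    by (intro sum_mono)
  also have "\<dots> = ennreal (real CARD('a) / ln 2)"
    by (subst sum_ennreal) auto
  finally show ?thesis .
qed

section \<open>Conditioning on the past\<close>

lemma log2_ereal_measurable [measurable]: "log2_ereal \<in> borel_measurable borel"
  unfolding log2_ereal_def[abs_def] by measurable

lemma divergence_term_measurable [measurable (raw)]:
  assumes [measurable]: "f \<in> borel_measurable N" "g \<in> borel_measurable N"
  shows "(\<lambda>\<omega>. divergence_term (f \<omega>) (g \<omega>)) \<in> borel_measurable N"
  unfolding divergence_term_def by measurable

lemma map_list_measurable:
  fixes Y :: "'i \<Rightarrow> 'w \<Rightarrow> 'a::countable"
  assumes Y: "\<And>i. i \<in> set is \<Longrightarrow> Y i \<in> measurable N (count_space UNIV)"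
  shows "(\<lambda>\<omega>. map (\<lambda>i. Y i \<omega>) is) \<in> measurable N (count_space UNIV)"
  using Y
proof (induction "is")
  case (Cons i "is")
  have "(\<lambda>\<omega>. a # map (\<lambda>i. Y i \<omega>) is) \<in> measurable N (count_space UNIV)" for a
    by (rule measurable_compose[OF Cons.IH]) (use Cons.prems in auto)
  then have "(\<lambda>\<omega>. Y i \<omega> # map (\<lambda>i. Y i \<omega>) is) \<in> measurable N (count_space UNIV)"
    by (rule measurable_compose_countable) (use Cons.prems in auto)
  then show ?case by simp
qed simp

locale finite_alphabet_process = prob_space M
  for M :: "'w measure" +
  fixes X :: "int \<Rightarrow> 'w \<Rightarrow> 'a::finite"
  assumes X_measurable [measurable]: "\<And>t. X t \<in> measurable M (count_space UNIV)"
begin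

lemma past_measurable:
  "past X \<in> measurable M (\<Pi>\<^sub>M t\<in>{..<0::int}. count_space UNIV)"
  unfolding past_def by (intro measurable_restrict) simp

lemma past_subalgebra: "subalgebra M (past_algebra M X)"
  unfolding subalgebra_def past_algebra_def
  using measurable_sets[OF past_measurable] measurable_space[OF past_measurable]
  by (auto simp: sets_vimage_algebra2)

sublocale past: finite_measure_subalgebra M "past_algebra M X"
  by unfold_locales (rule past_subalgebra)

lemma coordinate_past_measurable:
  assumes "t < 0"
  shows "X t \<in> measurable (past_algebra M X) (count_space UNIV)"
proof -
  have "past X \<in> measurable (past_algebra M X) (\<Pi>\<^sub>M t\<in>{..<0::int}. count_space UNIV)"
    unfolding past_algebra_def using measurable_space[OF past_measurable]
    by (intro measurable_vimage_algebra1) auto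
  then have "(\<lambda>\<omega>. past X \<omega> t) \<in> measurable (past_algebra M X) (count_space UNIV)"
    by (rule measurable_compose) (use assms in \<open>auto intro: measurable_component_singleton\<close>)
  then show ?thesis
    using assms by (simp add: past_def)
qed

lemma finite_past_measurable [measurable]:
  "finite_past X n \<in> measurable (past_algebra M X) (count_space UNIV)"
  unfolding finite_past_def
  by (intro map_list_measurable coordinate_past_measurable) auto

lemma estimate_past_measurable [measurable]:
  fixes Phat :: "nat \<Rightarrow> 'a list \<Rightarrow> 'a pmf"
  shows "(\<lambda>\<omega>. pmf (Phat n (finite_past X n \<omega>)) x) \<in> borel_measurable (past_algebra M X)"
  by (rule measurable_compose[OF finite_past_measurable]) simp

lemma cond_prob_past_measurable [measurable]:
  "cond_prob_past M X x \<in> borel_measurable (past_algebra M X)"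
  unfolding cond_prob_past_def by simp

lemma measurable_from_past:
  "f \<in> measurable (past_algebra M X) N \<Longrightarrow> f \<in> measurable M N"
  by (rule measurable_from_subalg[OF past_subalgebra])

text \<open>
  The conditional probabilities are chosen separately for each symbol. They form a probability
  mass function off a null set because conditional expectation is positive and linear and the
  indicators of the events that \<open>X 0 = x\<close> add up to 1.
\<close>

lemma AE_cond_prob_past_pmf:
  "AE \<omega> in M. (\<forall>x. 0 \<le> cond_prob_past M X x \<omega>) \<and> (\<Sum>x\<in>UNIV. cond_prob_past M X x \<omega>) = 1"
proof -
  have int: "integrable M (\<lambda>\<omega>. indicator {x} (X 0 \<omega>) :: real)" for x
    by (rule integrable_const_bound[where B = 1]) (auto split: split_indicator)
  have "AE \<omega> in M. \<forall>x\<in>UNIV. 0 \<le> cond_prob_past M X x \<omega>"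
    unfolding cond_prob_past_def
    by (intro AE_finite_allI past.real_cond_exp_pos) auto
  moreover have "AE \<omega> in M. (\<Sum>x\<in>UNIV. cond_prob_past M X x \<omega>) = 1"
  proof -
    have "(\<Sum>x\<in>UNIV. indicator {x} (X 0 \<omega>) :: real) = 1" for \<omega>
      by (simp add: indicator_def)
    then have "AE \<omega> in M. real_cond_exp M (past_algebra M X) (\<lambda>\<omega>. 1) \<omega>
        = (\<Sum>x\<in>UNIV. cond_prob_past M X x \<omega>)"
      using past.real_cond_exp_sum[of \<open>\<lambda>x \<omega>. indicator {x} (X 0 \<omega>)\<close>, OF int, where I = UNIV]
      by (simp add: cond_prob_past_def)
    moreover have "AE \<omega> in M. real_cond_exp M (past_algebra M X) (\<lambda>\<omega>. 1) \<omega> = 1"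
      by (intro past.real_cond_exp_F_meas) auto
    ultimately show ?thesis
      by eventually_elim simp
  qed
  ultimately show ?thesis
    by simp
qed

text \<open>
  Integrands below may be infinite, so the defining property of the conditional expectation is
  needed in its version for \<^typ>\<open>ennreal\<close>. The real-valued version agrees with it because the
  conditional expectation of an indicator is at most 1, hence finite.
\<close>

lemma nn_cond_exp_eq_cond_prob_past:
  "AE \<omega> in M. nn_cond_exp M (past_algebra M X) (\<lambda>\<omega>. ennreal (indicator {x} (X 0 \<omega>))) \<omega>
     = ennreal (cond_prob_past M X x \<omega>)"
proof -
  let ?N = "nn_cond_exp M (past_algebra M X)"
  have "AE \<omega> in M. ?N (\<lambda>\<omega>. ennreal (indicator {x} (X 0 \<omega>))) \<omega> \<le> ?N (\<lambda>\<omega>. 1) \<omega>"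
    by (intro past.nn_cond_exp_mono) (auto split: split_indicator)
  moreover have "AE \<omega> in M. 1 = ?N (\<lambda>\<omega>. 1) \<omega>"
    by (intro past.nn_cond_exp_F_meas) auto
  moreover have "AE \<omega> in M. 0 = ?N (\<lambda>\<omega>. 0) \<omega>"
    by (intro past.nn_cond_exp_F_meas) auto
  ultimately show ?thesis
  proof eventually_elim
    case (elim \<omega>)
    then have "?N (\<lambda>\<omega>. ennreal (indicator {x} (X 0 \<omega>))) \<omega> < \<top>"
      by (metis ennreal_one_less_top le_less_trans)
    then show ?case
      using elim by (simp add: cond_prob_past_def real_cond_exp_def ennreal_neg)
  qed
qed

text \<open>
  The tower property: split the integrand according to the value of the present symbol; on each
  piece \<open>g x\<close> depends on the past only, so the indicator of \<open>X 0 = x\<close> may be replaced by its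
  conditional expectation.
\<close>

lemma nn_integral_disintegrate_present:
  fixes g :: "'a \<Rightarrow> 'w \<Rightarrow> ennreal"
  assumes g: "\<And>x. g x \<in> borel_measurable (past_algebra M X)"
  shows "(\<integral>\<^sup>+ \<omega>. g (X 0 \<omega>) \<omega> \<partial>M)
           = (\<integral>\<^sup>+ \<omega>. (\<Sum>x\<in>UNIV. ennreal (cond_prob_past M X x \<omega>) * g x \<omega>) \<partial>M)"
proof -
  have [measurable]: "g x \<in> borel_measurable M" "cond_prob_past M X x \<in> borel_measurable M" for x
    by (auto intro: measurable_from_past g cond_prob_past_measurable)
  have "(\<integral>\<^sup>+ \<omega>. g (X 0 \<omega>) \<omega> \<partial>M)
      = (\<integral>\<^sup>+ \<omega>. (\<Sum>x\<in>UNIV. g x \<omega> * ennreal (indicator {x} (X 0 \<omega>))) \<partial>M)"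
    by (intro nn_integral_cong)
       (simp add: indicator_def of_bool_def if_distrib[of ennreal] if_distrib[of "(*) _"] cong: if_cong)
  also have "\<dots> = (\<Sum>x\<in>UNIV. \<integral>\<^sup>+ \<omega>. g x \<omega> * ennreal (indicator {x} (X 0 \<omega>)) \<partial>M)"
    by (intro nn_integral_sum) auto
  also have "\<dots> = (\<Sum>x\<in>UNIV. \<integral>\<^sup>+ \<omega>. g x \<omega> *
      nn_cond_exp M (past_algebra M X) (\<lambda>\<omega>. ennreal (indicator {x} (X 0 \<omega>))) \<omega> \<partial>M)"
    by (intro sum.cong refl past.nn_cond_exp_intg[symmetric] g) simp
  also have "\<dots> = (\<Sum>x\<in>UNIV. \<integral>\<^sup>+ \<omega>. ennreal (cond_prob_past M X x \<omega>) * g x \<omega> \<partial>M)"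
  proof (intro sum.cong refl nn_integral_cong_AE)
    fix x
    show "AE \<omega> in M. g x \<omega> *
        nn_cond_exp M (past_algebra M X) (\<lambda>\<omega>. ennreal (indicator {x} (X 0 \<omega>))) \<omega>
        = ennreal (cond_prob_past M X x \<omega>) * g x \<omega>"
      using nn_cond_exp_eq_cond_prob_past[of x] by eventually_elim (simp add: mult.commute)
  qed
  also have "\<dots> = (\<integral>\<^sup>+ \<omega>. (\<Sum>x\<in>UNIV. ennreal (cond_prob_past M X x \<omega>) * g x \<omega>) \<partial>M)"
    by (intro nn_integral_sum[symmetric]) auto
  finally show ?thesis .
qed

section \<open>Consistency in divergence and convergence of the log likelihoods\<close>

lemma nn_integral_abs_log_likelihood_diff:
  fixes Phat :: "nat \<Rightarrow> 'a list \<Rightarrow> 'a pmf"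
  shows "(\<integral>\<^sup>+ \<omega>. e2ennreal \<bar>log2_ereal (pmf (Phat n (finite_past X n \<omega>)) (X 0 \<omega>))
                      - log2_ereal (cond_prob_past M X (X 0 \<omega>) \<omega>)\<bar> \<partial>M)
       = (\<integral>\<^sup>+ \<omega>. mean_abs_log_ratio (\<lambda>x. cond_prob_past M X x \<omega>)
                      (Phat n (finite_past X n \<omega>)) \<partial>M)"
  unfolding mean_abs_log_ratio_def
  by (rule nn_integral_disintegrate_present) measurable

lemma expected_divergence_le:
  "expected_divergence M X Phat n
     \<le> (\<integral>\<^sup>+ \<omega>. mean_abs_log_ratio (\<lambda>x. cond_prob_past M X x \<omega>) (Phat n (finite_past X n \<omega>)) \<partial>M)"
  unfolding expected_divergence_def
  by (rule nn_integral_mono_AE, rule AE_mp[OF AE_cond_prob_past_pmf], intro AE_I2 impI)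
     (auto intro: divergence_le_mean_abs_log_ratio)

lemma expected_abs_log_ratio_le:
  assumes e: "e > 0"
  shows "(\<integral>\<^sup>+ \<omega>. mean_abs_log_ratio (\<lambda>x. cond_prob_past M X x \<omega>) (Phat n (finite_past X n \<omega>)) \<partial>M)
           \<le> ennreal (1 + 2 / (e * ln 2)) * expected_divergence M X Phat n + ennreal e"
proof -
  let ?D = "\<lambda>\<omega>. e2ennreal (info_divergence (\<lambda>x. cond_prob_past M X x \<omega>) (Phat n (finite_past X n \<omega>)))"
  have [measurable]: "?D \<in> borel_measurable M"
    unfolding info_divergence_def by (rule measurable_from_past) measurable
  have "(\<integral>\<^sup>+ \<omega>. mean_abs_log_ratio (\<lambda>x. cond_prob_past M X x \<omega>) (Phat n (finite_past X n \<omega>)) \<partial>M)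
      \<le> (\<integral>\<^sup>+ \<omega>. ennreal (1 + 2 / (e * ln 2)) * ?D \<omega> + ennreal e \<partial>M)"
    by (rule nn_integral_mono_AE, rule AE_mp[OF AE_cond_prob_past_pmf], intro AE_I2 impI)
       (auto intro: mean_abs_log_ratio_le_divergence e)
  also have "\<dots> = ennreal (1 + 2 / (e * ln 2)) * expected_divergence M X Phat n + ennreal e"
    by (simp add: nn_integral_add nn_integral_cmult expected_divergence_def emeasure_space_1)
  finally show ?thesis .
qed

lemma log_likelihood_integrable:
  "(\<integral>\<^sup>+ \<omega>. e2ennreal \<bar>log2_ereal (cond_prob_past M X (X 0 \<omega>) \<omega>)\<bar> \<partial>M) < \<infinity>"
proof -
  have "(\<integral>\<^sup>+ \<omega>. e2ennreal \<bar>log2_ereal (cond_prob_past M X (X 0 \<omega>) \<omega>)\<bar> \<partial>M)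
      = (\<integral>\<^sup>+ \<omega>. (\<Sum>x\<in>UNIV. ennreal (cond_prob_past M X x \<omega>)
            * e2ennreal \<bar>log2_ereal (cond_prob_past M X x \<omega>)\<bar>) \<partial>M)"
    by (rule nn_integral_disintegrate_present) measurable
  also have "\<dots> \<le> (\<integral>\<^sup>+ \<omega>. ennreal (real CARD('a) / ln 2) \<partial>M)"
  proof (rule nn_integral_mono_AE, rule AE_mp[OF AE_cond_prob_past_pmf], intro AE_I2 impI, elim conjE)
    fix \<omega>
    assume nonneg: "\<forall>x. 0 \<le> cond_prob_past M X x \<omega>"
      and "(\<Sum>x\<in>UNIV. cond_prob_past M X x \<omega>) = 1"
    then have "cond_prob_past M X x \<omega> \<le> 1" for x
      using member_le_sum[of x UNIV "\<lambda>x. cond_prob_past M X x \<omega>"] by simp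
    with nonneg show "(\<Sum>x\<in>UNIV. ennreal (cond_prob_past M X x \<omega>)
        * e2ennreal \<bar>log2_ereal (cond_prob_past M X x \<omega>)\<bar>) \<le> ennreal (real CARD('a) / ln 2)"
      by (intro entropy_bound) auto
  qed
  also have "\<dots> < \<infinity>"
    by (simp add: emeasure_space_1)
  finally show ?thesis .
qed

end

text \<open>
  For fixed \<open>e\<close> the bound makes every limit point of \<open>v\<close> at most \<open>e\<close>, however large \<open>K e\<close> is.
\<close>

lemma ennreal_tendsto_0_of_affine_bound:
  fixes u v :: "nat \<Rightarrow> ennreal" and K :: "real \<Rightarrow> real"
  assumes u: "u \<longlonglongrightarrow> 0"
    and bound: "\<And>e n. e > 0 \<Longrightarrow> v n \<le> ennreal (K e) * u n + ennreal e"
  shows "v \<longlonglongrightarrow> 0"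
proof (rule order_tendstoI)
  fix a :: ennreal
  assume "0 < a"
  then obtain e where e: "0 < e" "ennreal e < a"
    by (metis ennreal_cases dense ennreal_0 ennreal_less_zero_iff ennreal_less_top
        not_less_iff_gr_or_eq order.strict_trans)
  have "(\<lambda>n. ennreal (K e) * u n + ennreal e) \<longlonglongrightarrow> ennreal (K e) * 0 + ennreal e"
    by (intro tendsto_add ennreal_tendsto_cmult u tendsto_const) auto
  then have "eventually (\<lambda>n. ennreal (K e) * u n + ennreal e < a) sequentially"
    using e by (intro order_tendstoD) auto
  then show "eventually (\<lambda>n. v n < a) sequentially"
    by eventually_elim (use bound[OF e(1)] in \<open>auto intro: le_less_trans\<close>)
qed simp

theorem theorem5:
  fixes M :: "'w measure"
    and X :: "int \<Rightarrow> 'w \<Rightarrow> 'a::finite"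
    and Phat :: "nat \<Rightarrow> 'a list \<Rightarrow> 'a pmf"
  assumes "stationary_process M X"
  shows "(expected_divergence M X Phat \<longlonglongrightarrow> 0) \<longleftrightarrow>
         tendsto_L1 M (\<lambda>n \<omega>. log2_ereal (pmf (Phat n (finite_past X n \<omega>)) (X 0 \<omega>)))
                      (\<lambda>\<omega>. log2_ereal (cond_prob_past M X (X 0 \<omega>) \<omega>))"
proof -
  interpret finite_alphabet_process M X
    using assms by (auto simp: stationary_process_def finite_alphabet_process_def
        finite_alphabet_process_axioms_def)
  let ?gap = "\<lambda>n. \<integral>\<^sup>+ \<omega>. mean_abs_log_ratio (\<lambda>x. cond_prob_past M X x \<omega>)
                      (Phat n (finite_past X n \<omega>)) \<partial>M"
  have estimate: "(\<lambda>\<omega>. log2_ereal (pmf (Phat n (finite_past X n \<omega>)) (X 0 \<omega>))) \<in> borel_measurable M"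
    for n
    by (rule measurable_compose_countable[OF measurable_from_past X_measurable]) measurable
  have likelihood: "(\<lambda>\<omega>. log2_ereal (cond_prob_past M X (X 0 \<omega>) \<omega>)) \<in> borel_measurable M"
    by (rule measurable_compose_countable[OF measurable_from_past X_measurable]) measurable
  have "expected_divergence M X Phat \<longlonglongrightarrow> 0 \<longleftrightarrow> ?gap \<longlonglongrightarrow> 0"
  proof
    assume "expected_divergence M X Phat \<longlonglongrightarrow> 0"
    then show "?gap \<longlonglongrightarrow> 0"
      by (rule ennreal_tendsto_0_of_affine_bound) (rule expected_abs_log_ratio_le)
  next
    assume gap: "?gap \<longlonglongrightarrow> 0"
    show "expected_divergence M X Phat \<longlonglongrightarrow> 0"
      by (rule tendsto_sandwich[OF _ _ tendsto_const gap]) (simp_all add: expected_divergence_le)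
  qed
  then show ?thesis
    unfolding tendsto_L1_def nn_integral_abs_log_likelihood_diff
    using estimate likelihood log_likelihood_integrable by (metis (no_types, lifting))
qed

end
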